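(* For all $n\geq 1$ and all positive integers $m$, $\Omega_{\varepsilon Z_n}(m)=\Omega_{o\bar Z_n}(m)$, and consequently $A_{\varepsilon Z_n}(t)=A_{o\bar Z_n}(t)$.
   Context: For a poset $P$ on $[n]$, a $P$-partition is a map $f:[n]\to\{1,2,3,\dots\}$ such that whenever $i<_P j$: $f(i)\leq f(j)$ if $i<j$, and $f(i)<f(j)$ if $i>j$. The order polynomial $\Omega_P(m)$ is the number of $P$-partitions with all values in $\{1,\dots,m\}$. A linear extension of $P$ is a permutation $\pi\in S_n$ with $\pi^{-1}(i)<\pi^{-1}(j)$ whenever $i<_P j$; $\mathcal{L}(P)$ is the set of these. The $P$-Eulerian polynomial is $A_P(t)=\sum_{\pi\in\mathcal{L}(P)}t^{1+\mathrm{des}(\pi)}$, where $\mathrm{des}(\pi)=|\{i\in[n-1]:\pi(i)>\pi(i+1)\}|$. The zig-zag poset $Z_n$ on $[n]$ is generated by $j<j+1$ for odd $j$ and $j>j+1$ for even $j$ ($j\in[n-1]$); the down-up zig-zag poset $\bar Z_n$ is generated by $j>j+1$ for odd $j$ and $j<j+1$ for even $j$. For a permutation $\sigma\in S_n$ and a poset $Q$ on $[n]$, $\sigma Q$ is the poset on $[n]$ with $\sigma(i)<_{\sigma Q}\sigma(j)$ iff $i<_Q j$. Here $\varepsilon\in S_n$ is the involution swapping $2i$ and $2i+1$ for every $i\ge1$ with $2i+1\leq n$ (fixing other elements), and $o\in S_n$ is the involution swapping $2i-1$ and $2i$ for every $i\geq1$ with $2i\leq n$. *)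

theory Defs
  imports
    "HOL-Library.FuncSet"
    "HOL-Combinatorics.Permutations"
    "HOL-Computational_Algebra.Polynomial"
begin

text \<open>
  A poset on \<open>[n] = {1..n}\<close> is represented by its strict order relation \<open>P\<close>:
  \<open>(i, j) \<in> P\<close> means \<open>i <\<^sub>P j\<close>.
\<close>

definition poset_on :: "nat \<Rightarrow> (nat \<times> nat) set \<Rightarrow> bool" where
  "poset_on n P \<longleftrightarrow> P \<subseteq> {1..n} \<times> {1..n} \<and> irrefl P \<and> trans P"

definition P_partition :: "nat \<Rightarrow> (nat \<times> nat) set \<Rightarrow> (nat \<Rightarrow> nat) \<Rightarrow> bool" where
  "P_partition n P f \<longleftrightarrow>
     f \<in> {1..n} \<rightarrow>\<^sub>E {1..} \<and>
     (\<forall>i j. (i, j) \<in> P \<longrightarrow> (i < j \<longrightarrow> f i \<le> f j) \<and> (i > j \<longrightarrow> f i < f j))"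

definition order_poly :: "nat \<Rightarrow> (nat \<times> nat) set \<Rightarrow> nat \<Rightarrow> nat" where
  "order_poly n P m = card {f. P_partition n P f \<and> f ` {1..n} \<subseteq> {1..m}}"

definition lin_exts :: "nat \<Rightarrow> (nat \<times> nat) set \<Rightarrow> (nat \<Rightarrow> nat) set" where
  "lin_exts n P = {\<pi>. \<pi> permutes {1..n} \<and> (\<forall>i j. (i, j) \<in> P \<longrightarrow> inv \<pi> i < inv \<pi> j)}"

definition des :: "nat \<Rightarrow> (nat \<Rightarrow> nat) \<Rightarrow> nat" where
  "des n \<pi> = card {i \<in> {1..<n}. \<pi> i > \<pi> (i + 1)}"

definition eulerian_poly :: "nat \<Rightarrow> (nat \<times> nat) set \<Rightarrow> int poly" where
  "eulerian_poly n P = (\<Sum>\<pi>\<in>lin_exts n P. monom 1 (1 + des n \<pi>))"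

definition zigzag_rel :: "nat \<Rightarrow> (nat \<times> nat) set" where
  "zigzag_rel n =
     {(j, j + 1) | j. j \<in> {1..<n} \<and> odd j} \<union> {(j + 1, j) | j. j \<in> {1..<n} \<and> even j}"

definition down_up_rel :: "nat \<Rightarrow> (nat \<times> nat) set" where
  "down_up_rel n =
     {(j + 1, j) | j. j \<in> {1..<n} \<and> odd j} \<union> {(j, j + 1) | j. j \<in> {1..<n} \<and> even j}"

definition zigzag :: "nat \<Rightarrow> (nat \<times> nat) set" where
  "zigzag n = (zigzag_rel n)\<^sup>+"

definition down_up_zigzag :: "nat \<Rightarrow> (nat \<times> nat) set" where
  "down_up_zigzag n = (down_up_rel n)\<^sup>+"

definition relabel :: "(nat \<Rightarrow> nat) \<Rightarrow> (nat \<times> nat) set \<Rightarrow> (nat \<times> nat) set" where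
  "relabel \<sigma> Q = {(\<sigma> i, \<sigma> j) | i j. (i, j) \<in> Q}"

definition eps :: "nat \<Rightarrow> nat \<Rightarrow> nat" where
  "eps n k =
     (if even k \<and> 2 \<le> k \<and> k + 1 \<le> n then k + 1
      else if odd k \<and> 3 \<le> k \<and> k \<le> n then k - 1
      else k)"

definition omi :: "nat \<Rightarrow> nat \<Rightarrow> nat" where
  "omi n k =
     (if odd k \<and> k + 1 \<le> n then k + 1
      else if even k \<and> 2 \<le> k \<and> k \<le> n then k - 1
      else k)"

lemma eps_swaps:
  assumes "i \<ge> 1" "2 * i + 1 \<le> n"
  shows "eps n (2 * i) = 2 * i + 1" "eps n (2 * i + 1) = 2 * i"
  using assms by (auto simp: eps_def)

lemma omi_swaps:
  assumes "i \<ge> 1" "2 * i \<le> n"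
  shows "omi n (2 * i - 1) = 2 * i" "omi n (2 * i) = 2 * i - 1"
  using assms by (auto simp: omi_def)

lemma eps_involution: "eps n (eps n k) = k"
  unfolding eps_def by (cases "even k") (auto elim!: oddE)

lemma omi_involution: "omi n (omi n k) = k"
  unfolding omi_def by (cases "even k") (auto elim!: oddE)

lemma eps_permutes: "eps n permutes {1..n}"
  unfolding permutes_def
proof (intro conjI allI impI)
  fix k assume "k \<notin> {1..n}"
  then show "eps n k = k" by (auto simp: eps_def)
next
  fix k show "\<exists>!l. eps n l = k" by (metis eps_involution)
qed

lemma omi_permutes: "omi n permutes {1..n}"
  unfolding permutes_def
proof (intro conjI allI impI)
  fix k assume "k \<notin> {1..n}"
  then show "omi n k = k" by (cases k) (auto simp: omi_def)
next
  fix k show "\<exists>!l. omi n l = k" by (metis omi_involution)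
qed

lemma zigzag_eq: "zigzag n = zigzag_rel n"
  unfolding zigzag_def by (rule trancl_id) (auto simp: trans_def zigzag_rel_def)

lemma down_up_zigzag_eq: "down_up_zigzag n = down_up_rel n"
  unfolding down_up_zigzag_def by (rule trancl_id) (auto simp: trans_def down_up_rel_def)

lemma poset_on_zigzag: "poset_on n (zigzag n)"
  unfolding poset_on_def zigzag_eq
  by (auto simp: zigzag_rel_def irrefl_def trans_def)

lemma poset_on_down_up_zigzag: "poset_on n (down_up_zigzag n)"
  unfolding poset_on_def down_up_zigzag_eq
  by (auto simp: down_up_rel_def irrefl_def trans_def)

lemma relabel_iff:
  assumes "\<sigma> permutes {1..n}"
  shows "(\<sigma> i, \<sigma> j) \<in> relabel \<sigma> Q \<longleftrightarrow> (i, j) \<in> Q"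
  using permutes_inj[OF assms] by (auto simp: relabel_def dest: injD)

end

theory Submission
  imports Defs
begin

text \<open>
  Both relabelled zig-zag posets are naturally labelled (\<open>i <\<^sub>P j\<close> implies \<open>i < j\<close>), and their underlying
  posets are dual to each other. Dualising a naturally labelled poset while complementing its labels
  changes neither the order polynomial (complement the values of a \<open>P\<close>-partition) nor the Eulerian
  polynomial (reverse and complement a linear extension). It remains to see that neither
  polynomial depends on the choice of natural labelling. For order polynomials this is clear, all
  inequalities being weak. For Eulerian polynomials, two natural labellings are connected by
  exchanges of labels \<open>i\<close>, \<open>i + 1\<close> of incomparable elements. Such an exchange preserves
  the descents of the linear extensions in which \<open>i\<close> and \<open>i + 1\<close> are not
  adjacent, and leaves the set of the other linear extensions unchanged as a whole.
\<close>

section \<open>Exchanging the labels \<open>i\<close> and \<open>i + 1\<close>\<close>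

lemma relabel_relabel: "relabel \<sigma> (relabel \<tau> P) = relabel (\<sigma> \<circ> \<tau>) P"
  by (fastforce simp: relabel_def)

lemma relabel_id: "relabel id P = P"
  by (auto simp: relabel_def)

lemma lin_exts_relabel_iff:
  "\<pi> \<in> lin_exts n (relabel \<sigma> P) \<longleftrightarrow>
    \<pi> permutes {1..n} \<and> (\<forall>i j. (i, j) \<in> P \<longrightarrow> inv \<pi> (\<sigma> i) < inv \<pi> (\<sigma> j))"
  by (fastforce simp: lin_exts_def relabel_def)

text \<open>The only two values whose relative order changes are \<open>i\<close> and
  \<open>i + 1\<close>, and by \<open>nadj\<close> these never occupy consecutive positions, so no
  comparison counted by \<open>des\<close> is affected.\<close>

lemma des_transpose_comp:
  assumes \<pi>: "\<pi> permutes {1..n}"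
    and nadj: "inv \<pi> (i + 1) \<noteq> inv \<pi> i + 1" "inv \<pi> i \<noteq> inv \<pi> (i + 1) + 1"
  shows "des n (transpose i (i + 1) \<circ> \<pi>) = des n \<pi>"
proof -
  have "transpose i (i + 1) (\<pi> k) > transpose i (i + 1) (\<pi> (k + 1)) \<longleftrightarrow> \<pi> k > \<pi> (k + 1)" for k
  proof -
    have "\<not> (\<pi> k = i \<and> \<pi> (k + 1) = i + 1)" "\<not> (\<pi> k = i + 1 \<and> \<pi> (k + 1) = i)"
      using nadj permutes_inverses(2)[OF \<pi>, of k] permutes_inverses(2)[OF \<pi>, of "k + 1"] by auto
    moreover have "\<pi> k \<noteq> \<pi> (k + 1)"
      by (simp add: inj_eq[OF permutes_inj[OF \<pi>]])
    ultimately show ?thesis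
      by (auto simp: transpose_def)
  qed
  then show ?thesis
    by (simp add: des_def)
qed

text \<open>A descent-preserving involution \<open>\<phi>\<close> matches the two sets of linear
  extensions: it swaps the values \<open>i\<close> and \<open>i + 1\<close> unless they stand next
  to each other, in which case it does nothing.\<close>

lemma eulerian_poly_transpose:
  assumes i: "1 \<le> i" "i < n" and inc: "(i, i + 1) \<notin> P" "(i + 1, i) \<notin> P"
  shows "eulerian_poly n (relabel (transpose i (i + 1)) P) = eulerian_poly n P"
proof -
  define s where "s = transpose i (i + 1)"
  define adj where "adj \<pi> \<longleftrightarrow> inv \<pi> (i + 1) = inv \<pi> i + 1 \<or> inv \<pi> i = inv \<pi> (i + 1) + 1"
    for \<pi> :: "nat \<Rightarrow> nat"
  define \<phi> where "\<phi> \<pi> = (if adj \<pi> then \<pi> else s \<circ> \<pi>)" for \<pi>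
  have s: "s permutes {1..n}"
    unfolding s_def using i by (intro permutes_swap_id) auto
  have ss [simp]: "s (s x) = x" for x
    by (simp add: s_def)
  have inv_s: "inv (s \<circ> \<pi>) x = inv \<pi> (s x)" if "\<pi> permutes {1..n}" for \<pi> x
    using o_inv_distrib[OF permutes_bij[OF s] permutes_bij[OF that]]
    by (simp add: s_def)
  have adj_s: "adj (s \<circ> \<pi>) \<longleftrightarrow> adj \<pi>" if "\<pi> permutes {1..n}" for \<pi>
    unfolding adj_def inv_s[OF that] by (auto simp: s_def)
  have \<phi>\<phi>: "\<phi> (\<phi> \<pi>) = \<pi>" if "\<pi> permutes {1..n}" for \<pi>
    using adj_s[OF that] by (auto simp: \<phi>_def fun_eq_iff)
  \<comment> \<open>When \<open>i\<close> and \<open>i + 1\<close> are neighbours, no other value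
    stands between them, so swapping them changes the relative position of no other pair. As the two
    are incomparable, every constraint from \<open>P\<close> survives.\<close>
  have adj_mono: "inv \<pi> (s x) < inv \<pi> (s y)"
    if \<pi>: "\<pi> permutes {1..n}" and "adj \<pi>" "inv \<pi> x < inv \<pi> y"
      and "\<not> (x = i \<and> y = i + 1)" "\<not> (x = i + 1 \<and> y = i)" for \<pi> x y
  proof -
    have "inv \<pi> x = inv \<pi> y \<longleftrightarrow> x = y" for x y
      using permutes_inj[OF permutes_inv[OF \<pi>]] by (auto dest: injD)
    then have "inv \<pi> y = inv \<pi> i \<longleftrightarrow> y = i" "inv \<pi> y = inv \<pi> (i+1) \<longleftrightarrow> y = i + 1"
       "inv \<pi> x = inv \<pi> i \<longleftrightarrow> x = i" "inv \<pi> x = inv \<pi> (i+1) \<longleftrightarrow> x = i + 1" by blast+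
    then show ?thesis
      using that(2-) unfolding adj_def s_def transpose_def by (auto split: if_splits)
  qed
  have L: "\<pi> \<in> lin_exts n (relabel s P) \<longleftrightarrow>
    \<pi> permutes {1..n} \<and> (\<forall>x y. (x, y) \<in> P \<longrightarrow> inv \<pi> (s x) < inv \<pi> (s y))" for \<pi>
    by (rule lin_exts_relabel_iff)
  have 1: "\<phi> \<pi> \<in> lin_exts n P" if "\<pi> \<in> lin_exts n (relabel s P)" for \<pi>
  proof (cases "adj \<pi>")
    case True
    have "inv \<pi> x < inv \<pi> y" if "(x, y) \<in> P" for x y
    \<comment> \<open>The pair to which \<open>adj_mono\<close> applies is \<open>s x\<close>,
      \<open>s y\<close>; since \<open>s\<close> is an involution, the conclusion is about
      \<open>x\<close>, \<open>y\<close> again.\<close>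
    proof -
      have "\<not> (s x = i \<and> s y = i + 1)" "\<not> (s x = i + 1 \<and> s y = i)"
        using that inc by (auto simp: s_def transpose_def split: if_splits)
      then show ?thesis
        using adj_mono[of \<pi> "s x" "s y"] True that \<open>\<pi> \<in> _\<close> unfolding L by auto
    qed
    then show ?thesis
      using that True unfolding L by (auto simp: \<phi>_def lin_exts_def)
  next
    case False
    then show ?thesis
      using that inv_s[of \<pi>] permutes_compose[OF _ s] unfolding L
      by (auto simp: \<phi>_def lin_exts_def)
  qed
  have 2: "\<phi> \<pi> \<in> lin_exts n (relabel s P)" if "\<pi> \<in> lin_exts n P" for \<pi>
  proof (cases "adj \<pi>")
    case True
    have "inv \<pi> (s x) < inv \<pi> (s y)" if "(x, y) \<in> P" for x y
    proof -
      have "\<not> (x = i \<and> y = i + 1)" "\<not> (x = i + 1 \<and> y = i)"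
        using that inc by auto
      then show ?thesis
        using adj_mono[of \<pi> x y] True that \<open>\<pi> \<in> _\<close> by (auto simp: lin_exts_def)
    qed
    then show ?thesis
      using that True unfolding L by (auto simp: \<phi>_def lin_exts_def)
  next
    case False
    then show ?thesis
      using that inv_s[of \<pi>] permutes_compose[OF _ s] unfolding L
      by (auto simp: \<phi>_def lin_exts_def)
  qed
  have "des n (\<phi> \<pi>) = des n \<pi>" if "\<pi> permutes {1..n}" for \<pi>
    using des_transpose_comp[OF that, of i] by (auto simp: \<phi>_def adj_def s_def)
  then show ?thesis
    unfolding eulerian_poly_def s_def[symmetric]
    by (intro sum.reindex_bij_witness[of _ \<phi> \<phi>])
      (use 1 2 \<phi>\<phi> in \<open>auto simp: lin_exts_def\<close>)
qed

section \<open>Eulerian polynomials under change of natural labelling\<close>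

lemma permutes_nat_descent:
  fixes \<sigma> :: "nat \<Rightarrow> nat"
  assumes \<sigma>: "\<sigma> permutes {1..n}" and "\<sigma> \<noteq> id"
  shows "\<exists>i\<ge>1. i < n \<and> \<sigma> (i + 1) < \<sigma> i"
proof (rule ccontr)
  assume "\<not> ?thesis"
  then have le: "\<sigma> i \<le> \<sigma> (i + 1)" if "1 \<le> i" "i < n" for i
    using that by (meson not_less)
  have less: "\<sigma> i < \<sigma> (i + 1)" if "1 \<le> i" "i < n" for i
    using le[OF that] permutes_inj[OF \<sigma>] by (metis Suc_eq_plus1 injD le_neq_implies_less n_not_Suc_n)
  \<comment> \<open>Strictly increasing values starting at 1 or above lie on or above the diagonal,
    and a permutation of \<open>{1..n}\<close> with this property is the identity.\<close>
  have "i \<le> n \<longrightarrow> i \<le> \<sigma> i" if "1 \<le> i" for i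
    using that
  proof (induction i rule: dec_induct)
    case base
    then show ?case using permutes_in_image[OF \<sigma>, of 1] by auto
  next
    case (step i)
    then show ?case using less[of i] by auto
  qed
  then have "\<sigma> = id"
    by (intro permutes_natset_ge[OF \<sigma>]) auto
  with assms show False by simp
qed

text \<open>Bubble sort: as long as \<open>\<sigma>\<close> is not the identity, some labels
  \<open>i\<close> and \<open>i + 1\<close> are out of order and can be exchanged. By the
  rearrangement inequality each exchange increases the sum of \<open>k * \<sigma> k\<close>, which
  is at most \<open>n * (n * n)\<close>, so the process stops.\<close>

lemma eulerian_poly_natural_relabel:
  assumes "\<sigma> permutes {1..n}" "P \<subseteq> less_than" "relabel \<sigma> P \<subseteq> less_than"
  shows "eulerian_poly n (relabel \<sigma> P) = eulerian_poly n P"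
  using assms(1,3)
proof (induction "n * (n * n) - (\<Sum>k\<in>{1..n}. k * \<sigma> k)" arbitrary: \<sigma> rule: less_induct)
  case (less \<sigma>)
  note \<sigma> = less.prems(1)
  show ?case
  proof (cases "\<sigma> = id")
    case True
    then show ?thesis by (simp add: relabel_id)
  next
    case False
    then have "inv \<sigma> \<noteq> id"
      using \<sigma> by (metis inv_id permutes_inv_inv)
    then obtain i where i: "1 \<le> i" "i < n" "inv \<sigma> (i + 1) < inv \<sigma> i"
      using permutes_nat_descent[OF permutes_inv[OF \<sigma>]] by blast
    define s where "s = transpose i (i + 1)"
    define a where "a = inv \<sigma> (i + 1)"
    define b where "b = inv \<sigma> i"
    \<comment> \<open>The descent is taken in \<open>inv \<sigma>\<close> because the exchange acts
      on labels, that is, on values of \<open>\<sigma>\<close>: the smaller element \<open>a\<close>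
      carries the larger label.\<close>
    have ab: "\<sigma> a = i + 1" "\<sigma> b = i" "a < b"
      using i permutes_inverses(1)[OF \<sigma>] by (auto simp: a_def b_def)
    have abn: "a \<in> {1..n}" "b \<in> {1..n}"
      using ab i permutes_in_image[OF \<sigma>] by (metis atLeastAtMost_iff le_add2 less_iff_succ_less_eq less_imp_le_nat)+
    have "s permutes {1..n}"
      unfolding s_def using i by (intro permutes_swap_id) auto
    then have s\<sigma>: "s \<circ> \<sigma> permutes {1..n}"
      using \<sigma> permutes_compose by blast
    \<comment> \<open>Each labelling rules out one direction: \<open>P\<close> being natural
      excludes \<open>(b, a)\<close>, and \<open>relabel \<sigma> P\<close> being natural excludes
      \<open>(i + 1, i)\<close>.\<close>
    have inc: "(i, i + 1) \<notin> relabel \<sigma> P" "(i + 1, i) \<notin> relabel \<sigma> P"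
    proof -
      have "(b, a) \<notin> P" using assms(2) ab by auto
      then show "(i, i + 1) \<notin> relabel \<sigma> P"
        using relabel_iff[OF \<sigma>, of b a P] ab by simp
      show "(i + 1, i) \<notin> relabel \<sigma> P"
        using less.prems(2) by auto
    qed
    \<comment> \<open>The only pair \<open>u < v\<close> that \<open>s\<close> puts out of order is
      \<open>(i, i + 1)\<close>, which is not related.\<close>
    have nat: "relabel (s \<circ> \<sigma>) P \<subseteq> less_than"
      unfolding relabel_relabel[symmetric]
    proof (rule subrelI)
      fix x y assume "(x, y) \<in> relabel s (relabel \<sigma> P)"
      then obtain u v where uv: "(u, v) \<in> relabel \<sigma> P" "x = s u" "y = s v"
        unfolding relabel_def[of s] by blast
      then have "u < v" "\<not> (u = i \<and> v = i + 1)"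
        using less.prems(2) inc by auto
      then show "(x, y) \<in> less_than"
        using uv by (auto simp: s_def transpose_def)
    qed
    \<comment> \<open>Subtraction on naturals truncates, so the measure decreases strictly only
      because the new sum does not exceed the bound.\<close>
    have bound: "(\<Sum>k\<in>{1..n}. k * (s \<circ> \<sigma>) k) \<le> n * (n * n)"
    proof -
      have "(\<Sum>k\<in>{1..n}. k * (s \<circ> \<sigma>) k) \<le> of_nat (card {1..n}) * (n * n)"
      proof (rule sum_bounded_above)
        fix k assume "k \<in> {1..n}"
        moreover have "(s \<circ> \<sigma>) k \<in> {1..n}"
          using permutes_in_image[OF s\<sigma>] \<open>k \<in> _\<close> by blast
        ultimately show "k * (s \<circ> \<sigma>) k \<le> n * n"
          by (intro mult_le_mono) auto
      qed
      then show ?thesis by simp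
    qed
    have split: "(\<Sum>k\<in>{1..n}. k * f k) = a * f a + b * f b + (\<Sum>k\<in>{1..n} - {a} - {b}. k * f k)"
      for f :: "nat \<Rightarrow> nat"
      using abn ab by (subst sum.remove[of _ a], simp, simp, subst sum.remove[of _ b]) auto
    have "(\<Sum>k\<in>{1..n} - {a} - {b}. k * (s \<circ> \<sigma>) k) = (\<Sum>k\<in>{1..n} - {a} - {b}. k * \<sigma> k)"
    proof (rule sum.cong)
      fix k assume "k \<in> {1..n} - {a} - {b}"
      then have "\<sigma> k \<noteq> i" "\<sigma> k \<noteq> i + 1"
        using permutes_inverses(2)[OF \<sigma>, of k] unfolding a_def b_def by auto
      then show "k * (s \<circ> \<sigma>) k = k * \<sigma> k"
        by (simp add: s_def transpose_def)
    qed simp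
    \<comment> \<open>The terms at \<open>a\<close> and \<open>b\<close> change from
      \<open>a * (i + 1) + b * i\<close> to \<open>a * i + b * (i + 1)\<close>, a gain of
      \<open>b - a\<close>.\<close>
    then have "(\<Sum>k\<in>{1..n}. k * \<sigma> k) < (\<Sum>k\<in>{1..n}. k * (s \<circ> \<sigma>) k)"
      unfolding split using ab by (simp add: s_def)
    then have "eulerian_poly n (relabel (s \<circ> \<sigma>) P) = eulerian_poly n P"
      using bound by (intro less.hyps[OF _ s\<sigma> nat]) linarith
    moreover have "eulerian_poly n (relabel (s \<circ> \<sigma>) P) = eulerian_poly n (relabel \<sigma> P)"
      unfolding relabel_relabel[symmetric] s_def
      using i inc by (intro eulerian_poly_transpose) auto
    ultimately show ?thesis by simp
  qed
qed

section \<open>Duality for Eulerian polynomials\<close>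

definition complement :: "nat \<Rightarrow> nat \<Rightarrow> nat" where
  "complement n k = (if k \<in> {1..n} then n + 1 - k else k)"

lemma complement_involution: "complement n (complement n k) = k"
  by (auto simp: complement_def)

lemma complement_permutes: "complement n permutes {1..n}"
  unfolding permutes_def
proof (intro conjI allI impI)
  fix k assume "k \<notin> {1..n}"
  then show "complement n k = k" unfolding complement_def by (rule if_not_P)
next
  fix k show "\<exists>!l. complement n l = k" by (metis complement_involution)
qed

lemma complement_less_iff:
  "x \<in> {1..n} \<Longrightarrow> y \<in> {1..n} \<Longrightarrow> complement n x < complement n y \<longleftrightarrow> y < x"
  by (auto simp: complement_def)

text \<open>Reversing the word and complementing its values each turn descents into ascents, so
  together they keep descents and move the one at position \<open>k\<close> to position
  \<open>n - k\<close>.\<close>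

lemma des_reverse_complement:
  assumes \<pi>: "\<pi> permutes {1..n}"
  shows "des n (complement n \<circ> \<pi> \<circ> complement n) = des n \<pi>"
proof -
  have "bij_betw (\<lambda>k. n - k) {k \<in> {1..<n}. (complement n \<circ> \<pi> \<circ> complement n) k >
      (complement n \<circ> \<pi> \<circ> complement n) (k + 1)} {k \<in> {1..<n}. \<pi> k > \<pi> (k + 1)}"
  proof (rule bij_betw_byWitness[where f' = "\<lambda>k. n - k"])
    have *: "(complement n \<circ> \<pi> \<circ> complement n) k > (complement n \<circ> \<pi> \<circ> complement n) (k + 1)
      \<longleftrightarrow> \<pi> (n - k) > \<pi> (n - k + 1)" if "k \<in> {1..<n}" for k
    proof -
      \<comment> \<open>The consecutive positions \<open>k\<close> and \<open>k + 1\<close> are read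
        in reverse order here; the outer complement then reverses the comparison of values
        back.\<close>
      have "complement n k = n - k + 1" "complement n (k + 1) = n - k"
        using that by (auto simp: complement_def)
      moreover have "\<pi> (n - k + 1) \<in> {1..n}" "\<pi> (n - k) \<in> {1..n}"
        using that by (auto simp only: permutes_in_image[OF \<pi>]) auto
      ultimately show ?thesis
        by (simp only: o_apply complement_less_iff)
    qed
    show "(\<lambda>k. n - k) ` {k \<in> {1..<n}. (complement n \<circ> \<pi> \<circ> complement n) k >
      (complement n \<circ> \<pi> \<circ> complement n) (k + 1)} \<subseteq> {k \<in> {1..<n}. \<pi> k > \<pi> (k + 1)}"
      using * by auto
    show "(\<lambda>k. n - k) ` {k \<in> {1..<n}. \<pi> k > \<pi> (k + 1)} \<subseteq> {k \<in> {1..<n}.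
      (complement n \<circ> \<pi> \<circ> complement n) k > (complement n \<circ> \<pi> \<circ> complement n) (k + 1)}"
    proof clarify
      fix k assume "k \<in> {1..<n}" "\<pi> (k + 1) < \<pi> k"
      then show "n - k \<in> {1..<n} \<and> (complement n \<circ> \<pi> \<circ> complement n) (n - k + 1) <
        (complement n \<circ> \<pi> \<circ> complement n) (n - k)"
        using *[of "n - k"] by auto
    qed
  qed auto
  then show ?thesis
    unfolding des_def by (rule bij_betw_same_card)
qed

text \<open>Conjugation by \<open>complement n\<close> also conjugates the inverse. Hence
  \<open>x\<close> precedes \<open>y\<close> in a permutation exactly when the complement of
  \<open>y\<close> precedes that of \<open>x\<close> in its conjugate, which is the condition for
  the dual poset with complemented labels.\<close>

lemma eulerian_poly_dual:
  assumes P: "P \<subseteq> {1..n} \<times> {1..n}"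
  shows "eulerian_poly n (relabel (complement n) (P\<inverse>)) = eulerian_poly n P"
proof -
  let ?c = "complement n"
  have perm: "?c \<circ> \<pi> \<circ> ?c permutes {1..n}" if "\<pi> permutes {1..n}" for \<pi>
    using that complement_permutes by (intro permutes_compose)
  have inv: "inv (?c \<circ> \<pi> \<circ> ?c) x = ?c (inv \<pi> (?c x))" if \<pi>: "\<pi> permutes {1..n}" for \<pi> x
  proof -
    have "inv (?c \<circ> \<pi> \<circ> ?c) = ?c \<circ> inv \<pi> \<circ> ?c"
      using permutes_inverses[OF \<pi>]
      by (intro inv_unique_comp) (auto simp: complement_involution fun_eq_iff)
    then show ?thesis by simp
  qed
  have inv_in: "inv \<pi> x \<in> {1..n}" if "\<pi> permutes {1..n}" "x \<in> {1..n}" for \<pi> x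
    using that(2) unfolding permutes_in_image[OF permutes_inv[OF that(1)]] .
  have cinv_less: "?c (inv \<pi> y) < ?c (inv \<pi> x) \<longleftrightarrow> inv \<pi> x < inv \<pi> y"
    if "\<pi> permutes {1..n}" "x \<in> {1..n}" "y \<in> {1..n}" for \<pi> x y
    using complement_less_iff inv_in that by blast
  have cc: "?c x \<in> {1..n}" if "x \<in> {1..n}" for x
    using that permutes_in_image[OF complement_permutes] by blast
  have 1: "?c \<circ> \<pi> \<circ> ?c \<in> lin_exts n P" if "\<pi> \<in> lin_exts n (relabel ?c (P\<inverse>))" for \<pi>
  proof -
    have \<pi>: "\<pi> permutes {1..n}" "\<And>x y. (x, y) \<in> P \<Longrightarrow> inv \<pi> (?c y) < inv \<pi> (?c x)"
      using that unfolding lin_exts_relabel_iff by auto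
    have "inv (?c \<circ> \<pi> \<circ> ?c) x < inv (?c \<circ> \<pi> \<circ> ?c) y" if "(x, y) \<in> P" for x y
      using \<pi>(2)[OF that] cinv_less[OF \<pi>(1)] cc that P unfolding inv[OF \<pi>(1)] by blast
    then show ?thesis
      using perm[OF \<pi>(1)] by (simp add: lin_exts_def)
  qed
  have 2: "?c \<circ> \<pi> \<circ> ?c \<in> lin_exts n (relabel ?c (P\<inverse>))" if "\<pi> \<in> lin_exts n P" for \<pi>
  proof -
    have \<pi>: "\<pi> permutes {1..n}" "\<And>x y. (x, y) \<in> P \<Longrightarrow> inv \<pi> x < inv \<pi> y"
      using that by (auto simp: lin_exts_def)
    have "inv (?c \<circ> \<pi> \<circ> ?c) (?c y) < inv (?c \<circ> \<pi> \<circ> ?c) (?c x)" if "(x, y) \<in> P" for x y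
      using \<pi>(2)[OF that] cinv_less[OF \<pi>(1)] that P
      unfolding inv[OF \<pi>(1)] complement_involution by blast
    then show ?thesis
      using perm[OF \<pi>(1)] unfolding lin_exts_relabel_iff by auto
  qed
  show ?thesis
    unfolding eulerian_poly_def
    by (rule sum.reindex_bij_witness[of _ "\<lambda>\<pi>. ?c \<circ> \<pi> \<circ> ?c" "\<lambda>\<pi>. ?c \<circ> \<pi> \<circ> ?c"])
      (use 1 2 in \<open>auto simp: complement_involution fun_eq_iff lin_exts_def
        des_reverse_complement\<close>)
qed

section \<open>Order polynomials of naturally labelled posets\<close>

lemma order_poly_natural:
  assumes "P \<subseteq> less_than"
  shows "order_poly n P m =
    card {f \<in> {1..n} \<rightarrow>\<^sub>E {1..m}. \<forall>i j. (i, j) \<in> P \<longrightarrow> f i \<le> f j}"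
proof -
  \<comment> \<open>Related elements always satisfy \<open>i < j\<close>, so the strict clause of
    \<open>P_partition\<close> is vacuous and only weak inequalities remain.\<close>
  have "P_partition n P f \<and> f ` {1..n} \<subseteq> {1..m} \<longleftrightarrow>
    f \<in> {1..n} \<rightarrow>\<^sub>E {1..m} \<and> (\<forall>i j. (i, j) \<in> P \<longrightarrow> f i \<le> f j)" for f
    using assms unfolding P_partition_def PiE_iff by (auto 0 4)
  then show ?thesis by (simp add: order_poly_def)
qed

text \<open>Weak inequalities depend on the poset and not on its labels, so composing with
  \<open>\<sigma>\<close> transports the maps from one labelling to the other.\<close>

lemma order_poly_natural_relabel:
  assumes \<sigma>: "\<sigma> permutes {1..n}" and P: "P \<subseteq> less_than" "relabel \<sigma> P \<subseteq> less_than"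
  shows "order_poly n (relabel \<sigma> P) m = order_poly n P m"
proof -
  \<comment> \<open>Both directions matter: arguments outside \<open>{1..n}\<close> stay outside, so
    composition keeps the value \<open>undefined\<close> there.\<close>
  have \<sigma>_in: "\<sigma> x \<in> {1..n} \<longleftrightarrow> x \<in> {1..n}" "inv \<sigma> x \<in> {1..n} \<longleftrightarrow> x \<in> {1..n}" for x
    using permutes_in_image[OF \<sigma>] permutes_in_image[OF permutes_inv[OF \<sigma>]] by blast+
  note inv = permutes_inverses[OF \<sigma>]
  have "bij_betw (\<lambda>f. f \<circ> \<sigma>)
    {f \<in> {1..n} \<rightarrow>\<^sub>E {1..m}. \<forall>i j. (i, j) \<in> relabel \<sigma> P \<longrightarrow> f i \<le> f j}
    {f \<in> {1..n} \<rightarrow>\<^sub>E {1..m}. \<forall>i j. (i, j) \<in> P \<longrightarrow> f i \<le> f j}"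
  proof (rule bij_betw_byWitness[where f' = "\<lambda>f. f \<circ> inv \<sigma>"])
    show "(\<lambda>f. f \<circ> \<sigma>) ` {f \<in> {1..n} \<rightarrow>\<^sub>E {1..m}. \<forall>i j. (i, j) \<in> relabel \<sigma> P \<longrightarrow> f i \<le> f j}
      \<subseteq> {f \<in> {1..n} \<rightarrow>\<^sub>E {1..m}. \<forall>i j. (i, j) \<in> P \<longrightarrow> f i \<le> f j}"
      using \<sigma>_in relabel_iff[OF \<sigma>]
      by (auto simp: PiE_iff extensional_def simp del: atLeastAtMost_iff)
    show "(\<lambda>f. f \<circ> inv \<sigma>) ` {f \<in> {1..n} \<rightarrow>\<^sub>E {1..m}. \<forall>i j. (i, j) \<in> P \<longrightarrow> f i \<le> f j}
      \<subseteq> {f \<in> {1..n} \<rightarrow>\<^sub>E {1..m}. \<forall>i j. (i, j) \<in> relabel \<sigma> P \<longrightarrow> f i \<le> f j}"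
      using \<sigma>_in
      by (auto simp: PiE_iff extensional_def relabel_def inv simp del: atLeastAtMost_iff)
  qed (auto simp: fun_eq_iff inv)
  then show ?thesis
    unfolding order_poly_natural[OF P(1)] order_poly_natural[OF P(2)]
    by (rule bij_betw_same_card)
qed

text \<open>Taking the converse and complementing the labels both reverse the order, and the two
  reversals cancel.\<close>

lemma natural_dual:
  assumes "P \<subseteq> {1..n} \<times> {1..n}" "P \<subseteq> less_than"
  shows "relabel (complement n) (P\<inverse>) \<subseteq> less_than"
proof (rule subrelI)
  fix x y assume "(x, y) \<in> relabel (complement n) (P\<inverse>)"
  then obtain i j where ij: "(j, i) \<in> P" "x = complement n i" "y = complement n j"
    unfolding relabel_def by blast
  then have "j < i" "i \<in> {1..n}" "j \<in> {1..n}"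
    using assms by auto
  then show "(x, y) \<in> less_than"
    using ij by (simp only: complement_less_iff less_than_iff)
qed

lemma order_poly_dual:
  assumes "P \<subseteq> {1..n} \<times> {1..n}" "P \<subseteq> less_than"
  shows "order_poly n (relabel (complement n) (P\<inverse>)) m = order_poly n P m"
proof -
  let ?c = "complement n"
  \<comment> \<open>Arguments are complemented in \<open>{1..n}\<close> and values in
    \<open>{1..m}\<close>. The restriction is there because \<open>undefined\<close> might lie in
    \<open>{1..m}\<close> and be moved by \<open>complement m\<close>.\<close>
  let ?\<phi> = "\<lambda>f. restrict (complement m \<circ> f \<circ> ?c) {1..n}"
  have nat: "relabel ?c (P\<inverse>) \<subseteq> less_than"
    using assms by (rule natural_dual)
  have c_in: "complement k x \<in> {1..k} \<longleftrightarrow> x \<in> {1..k}" for k x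
    using permutes_in_image[OF complement_permutes] by blast
  have anti: "complement m y \<le> complement m x" if "x \<le> y" "x \<in> {1..m}" "y \<in> {1..m}" for x y
    using that by (auto simp: complement_def)
  have "bij_betw ?\<phi>
    {f \<in> {1..n} \<rightarrow>\<^sub>E {1..m}. \<forall>i j. (i, j) \<in> relabel ?c (P\<inverse>) \<longrightarrow> f i \<le> f j}
    {f \<in> {1..n} \<rightarrow>\<^sub>E {1..m}. \<forall>i j. (i, j) \<in> P \<longrightarrow> f i \<le> f j}" (is "bij_betw _ ?A ?B")
  proof (rule bij_betw_byWitness[where f' = ?\<phi>])
    have inv: "?\<phi> (?\<phi> f) = f" if "f \<in> {1..n} \<rightarrow>\<^sub>E {1..m}" for f
      using that c_in
      by (auto simp: fun_eq_iff PiE_iff extensional_def restrict_def complement_involution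
        simp del: atLeastAtMost_iff)
    then show "\<forall>f\<in>?A. ?\<phi> (?\<phi> f) = f" "\<forall>f\<in>?B. ?\<phi> (?\<phi> f) = f" by blast+
    have fun_mem: "?\<phi> f \<in> {1..n} \<rightarrow>\<^sub>E {1..m}" if "f \<in> {1..n} \<rightarrow>\<^sub>E {1..m}" for f
      using that c_in by (auto simp: PiE_iff simp del: atLeastAtMost_iff)
    show "?\<phi> ` ?A \<subseteq> ?B"
    proof (intro subsetI, elim imageE, hypsubst, intro CollectI conjI allI impI)
      fix f assume f: "f \<in> ?A"
      then show "?\<phi> f \<in> {1..n} \<rightarrow>\<^sub>E {1..m}" using fun_mem by blast
      fix i j assume ij: "(i, j) \<in> P"
      then have ijn: "i \<in> {1..n}" "j \<in> {1..n}" using assms by auto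
      have "(?c j, ?c i) \<in> relabel ?c (P\<inverse>)"
        using ij by (auto simp: relabel_def)
      then have "f (?c j) \<le> f (?c i)" using f by blast
      moreover have "f (?c i) \<in> {1..m}" "f (?c j) \<in> {1..m}"
        using f ijn c_in by (auto simp: PiE_iff simp del: atLeastAtMost_iff)
      ultimately show "?\<phi> f i \<le> ?\<phi> f j"
        using anti ijn by simp
    qed
    show "?\<phi> ` ?B \<subseteq> ?A"
    proof (intro subsetI, elim imageE, hypsubst, intro CollectI conjI allI impI)
      fix f assume f: "f \<in> ?B"
      then show "?\<phi> f \<in> {1..n} \<rightarrow>\<^sub>E {1..m}" using fun_mem by blast
      fix i j assume "(i, j) \<in> relabel ?c (P\<inverse>)"
      then have ij: "(?c j, ?c i) \<in> P"
        by (auto simp: relabel_def complement_involution)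
      then have "?c i \<in> {1..n}" "?c j \<in> {1..n}" using assms by auto
      then have ijn: "i \<in> {1..n}" "j \<in> {1..n}" by (simp_all only: c_in)
      have "f (?c j) \<le> f (?c i)" using f ij by blast
      moreover have "f (?c i) \<in> {1..m}" "f (?c j) \<in> {1..m}"
        using f ijn c_in by (auto simp: PiE_iff simp del: atLeastAtMost_iff)
      ultimately show "?\<phi> f i \<le> ?\<phi> f j"
        using anti ijn by simp
    qed
  qed
  then show ?thesis
    unfolding order_poly_natural[OF assms(2)] order_poly_natural[OF nat]
    by (rule bij_betw_same_card)
qed

section \<open>The two relabelled zig-zag posets\<close>

lemma relabel_eps_zigzag_natural: "relabel (eps n) (zigzag n) \<subseteq> less_than"
proof -
  \<comment> \<open>For odd \<open>j\<close> the elements \<open>j\<close> and \<open>j + 1\<close>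
    belong to different swapped blocks, so their order is kept; for even \<open>j\<close> they form
    one block, and the swap corrects the relation \<open>j + 1\<close> below
    \<open>j\<close>.\<close>
  have "eps n j < eps n (j + 1)" if "odd j" for j
    using that by (auto simp: eps_def)
  moreover have "eps n (j + 1) < eps n j" if "even j" "1 \<le> j" "j < n" for j
  proof -
    have "j \<noteq> 1" using that by auto
    then show ?thesis using that by (auto simp: eps_def)
  qed
  ultimately show ?thesis
    unfolding zigzag_eq zigzag_rel_def relabel_def by fastforce
qed

lemma relabel_omi_down_up_natural: "relabel (omi n) (down_up_zigzag n) \<subseteq> less_than"
proof -
  \<comment> \<open>The parities are exchanged: the blocks of \<open>omi\<close> start at odd
    \<open>j\<close>, which is where the down-up zig-zag descends.\<close>
  have "omi n (j + 1) < omi n j" if "odd j" "1 \<le> j" "j < n" for j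
    using that by (auto simp: omi_def)
  moreover have "omi n j < omi n (j + 1)" if "even j" "1 \<le> j" for j
    using that by (auto simp: omi_def)
  ultimately show ?thesis
    unfolding down_up_zigzag_eq down_up_rel_def relabel_def by fastforce
qed

lemma converse_zigzag: "(zigzag n)\<inverse> = down_up_zigzag n"
  unfolding zigzag_eq down_up_zigzag_eq zigzag_rel_def down_up_rel_def by auto

lemma converse_relabel: "(relabel \<sigma> P)\<inverse> = relabel \<sigma> (P\<inverse>)"
  by (auto simp: relabel_def)

theorem theorem2p4:
  fixes n :: nat
  assumes "n \<ge> 1"
  shows "(\<forall>m::nat. m \<ge> 1 \<longrightarrow>
           order_poly n (relabel (eps n) (zigzag n)) m =
           order_poly n (relabel (omi n) (down_up_zigzag n)) m) \<and>
         eulerian_poly n (relabel (eps n) (zigzag n)) =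
         eulerian_poly n (relabel (omi n) (down_up_zigzag n))"
proof -
  define P where "P = relabel (eps n) (zigzag n)"
  define Q where "Q = relabel (complement n) (P\<inverse>)"
  \<comment> \<open>\<open>Q\<close> is the down-up zig-zag relabelled by
    \<open>complement n \<circ> eps n\<close>. Both factors are involutions, so this
    \<open>\<sigma>\<close> undoes that relabelling and then applies \<open>omi n\<close>.\<close>
  define \<sigma> where "\<sigma> = omi n \<circ> eps n \<circ> complement n"
  have "zigzag n \<subseteq> {1..n} \<times> {1..n}"
    using poset_on_zigzag by (simp add: poset_on_def)
  then have P: "P \<subseteq> {1..n} \<times> {1..n}"
    using permutes_in_image[OF eps_permutes] unfolding P_def relabel_def by blast
  have P_nat: "P \<subseteq> less_than"
    unfolding P_def by (rule relabel_eps_zigzag_natural)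
  have Q_nat: "Q \<subseteq> less_than"
    unfolding Q_def using P P_nat by (rule natural_dual)
  have \<sigma>: "\<sigma> permutes {1..n}"
    unfolding \<sigma>_def by (intro permutes_compose complement_permutes eps_permutes omi_permutes)
  have "\<sigma> \<circ> complement n \<circ> eps n = omi n"
    by (simp add: \<sigma>_def fun_eq_iff complement_involution eps_involution)
  then have \<sigma>Q: "relabel \<sigma> Q = relabel (omi n) (down_up_zigzag n)"
    by (simp add: Q_def P_def converse_relabel converse_zigzag relabel_relabel comp_assoc)
  then have \<sigma>Q_nat: "relabel \<sigma> Q \<subseteq> less_than"
    using relabel_omi_down_up_natural by simp
  \<comment> \<open>Duality leads from \<open>P\<close> to \<open>Q\<close>, and the change of
    natural labelling from \<open>Q\<close> to \<open>relabel \<sigma> Q\<close>; the Eulerian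
    polynomials follow the same route.\<close>
  have "order_poly n P m = order_poly n (relabel \<sigma> Q) m" for m
    using order_poly_dual[OF P P_nat] order_poly_natural_relabel[OF \<sigma> Q_nat \<sigma>Q_nat]
    unfolding Q_def by simp
  moreover have "eulerian_poly n P = eulerian_poly n (relabel \<sigma> Q)"
    using eulerian_poly_dual[OF P] eulerian_poly_natural_relabel[OF \<sigma> Q_nat \<sigma>Q_nat]
    unfolding Q_def by simp
  ultimately show ?thesis
    unfolding P_def \<sigma>Q by blast
qed

end
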